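(* Let $D(x)=\mathbf{W}x$ be a linear operator on $\mathbb{R}^n$, where $\mathbf{W}\in\mathbb{R}^{n\times n}$ is diagonalizable with all eigenvalues in $[0,1]$, let $\mathbf{V}\in\mathbb{R}^{n\times n}$ be a matrix whose columns are linearly independent eigenvectors of $\mathbf{W}$, and equip $\mathbb{R}^n$ with the inner product $\langle x,y\rangle=(\mathbf{V}^{-1}x)^\top(\mathbf{V}^{-1}y)$ (an inner product induced by $D$). Let $g_D:\mathbb{R}^n\to\mathbb{R}\cup\{\infty\}$ be a closed, proper and convex function such that $D=\mathrm{Prox}_{g_D}$ on $(\mathbb{R}^n,\langle\cdot,\cdot\rangle)$. Let $f:\mathbb{R}^n\to\mathbb{R}$ be convex and $\beta$-smooth on $(\mathbb{R}^n,\langle\cdot,\cdot\rangle)$ with $\beta>0$, and let $\rho>\beta/2$. Assume that $x^\ast$ is a minimizer of $$\min_{x\in\mathbb{R}^n}\ f(x)+\rho\,g_D(x),$$ and let $p^\ast=f(x^\ast)+\rho\,g_D(x^\ast)$. Then, for any $x_0\in\mathbb{R}^n$: (a) the PnP-ISTA iterates $(x_k)_{k\ge0}$ generated by $x_{k+1}=D(x_k-\rho^{-1}\nabla f(x_k))$ converge to a minimizer of $f+\rho\,g_D$; and (b) $\lim_{k\to\infty} f(x_k)+\rho\,g_D(x_k)=p^\ast$.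
   Context: Let $\|\cdot\|$ be the norm induced by $\langle\cdot,\cdot\rangle$. Proximal operator on $(\mathbb{R}^n,\langle\cdot,\cdot\rangle)$: for closed, proper, convex $h$, $\mathrm{Prox}_h(x)=\arg\min_{y}\ \tfrac12\|y-x\|^2+h(y)$. (For $D$ and $\langle\cdot,\cdot\rangle$ as in the statement, a closed proper convex $g_D$ with $D=\mathrm{Prox}_{g_D}$ always exists.) Gradient: for differentiable $f$ with derivative $L(x)$ at $x$, $\nabla f(x)$ is the unique vector with $L(x)(h)=\langle\nabla f(x),h\rangle$ for all $h\in\mathbb{R}^n$ (so it is taken with respect to $\langle\cdot,\cdot\rangle$). $\beta$-smooth: $f$ is differentiable and $\|\nabla f(x)-\nabla f(y)\|\le\beta\|x-y\|$ for all $x,y\in\mathbb{R}^n$. *)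

theory Defs
  imports "HOL-Analysis.Analysis"
begin

definition eigenvector :: "real^'n^'n \<Rightarrow> real^'n \<Rightarrow> real \<Rightarrow> bool" where
  "eigenvector A v \<mu> \<longleftrightarrow> v \<noteq> 0 \<and> A *v v = \<mu> *\<^sub>R v"

definition eigenvalue :: "real^'n^'n \<Rightarrow> real \<Rightarrow> bool" where
  "eigenvalue A \<mu> \<longleftrightarrow> (\<exists>v. eigenvector A v \<mu>)"

text \<open>Diagonalizability is over the reals; the spectrum of such a matrix consists of real
  eigenvalues only.\<close>

definition diagonalizable :: "real^'n^'n \<Rightarrow> bool" where
  "diagonalizable A \<longleftrightarrow>
     (\<exists>P \<Lambda> :: real^'n^'n. invertible P \<and> (\<forall>i j. i \<noteq> j \<longrightarrow> \<Lambda> $ i $ j = 0) \<and> A = P ** \<Lambda> ** matrix_inv P)"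

text \<open>The injectivity requirement makes the columns independent as an indexed family:
  the library's set of columns identifies equal columns.\<close>

definition eigenvector_basis :: "real^'n^'n \<Rightarrow> real^'n^'n \<Rightarrow> bool" where
  "eigenvector_basis A V \<longleftrightarrow>
     (\<forall>i. \<exists>\<mu>. eigenvector A (column i V) \<mu>) \<and>
     inj (\<lambda>i. column i V) \<and> independent (columns V)"

definition induced_inner :: "real^'n^'n \<Rightarrow> real^'n \<Rightarrow> real^'n \<Rightarrow> real" where
  "induced_inner V x y = (matrix_inv V *v x) \<bullet> (matrix_inv V *v y)"

text \<open>The following notions are relative to an inner product \<open>ip\<close>, in general different
  from the standard one. Differentiability, closedness and limits in finite dimension do not depend
  on this choice, so the library notions are used for them.\<close>

definition ip_norm :: "(real^'n \<Rightarrow> real^'n \<Rightarrow> real) \<Rightarrow> real^'n \<Rightarrow> real" where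
  "ip_norm ip x = sqrt (ip x x)"

definition ip_gradient ::
    "(real^'n \<Rightarrow> real^'n \<Rightarrow> real) \<Rightarrow> (real^'n \<Rightarrow> real) \<Rightarrow> real^'n \<Rightarrow> real^'n" where
  "ip_gradient ip f x = (THE v. \<forall>h. frechet_derivative f (at x) h = ip v h)"

definition ip_smooth ::
    "(real^'n \<Rightarrow> real^'n \<Rightarrow> real) \<Rightarrow> real \<Rightarrow> (real^'n \<Rightarrow> real) \<Rightarrow> bool" where
  "ip_smooth ip \<beta> f \<longleftrightarrow>
     (\<forall>x. f differentiable (at x)) \<and>
     (\<forall>x y. ip_norm ip (ip_gradient ip f x - ip_gradient ip f y) \<le> \<beta> * ip_norm ip (x - y))"

definition ereal_epigraph :: "(real^'n \<Rightarrow> ereal) \<Rightarrow> ((real^'n) \<times> real) set" where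
  "ereal_epigraph h = {(x, r). h x \<le> ereal r}"

definition closed_proper_convex :: "(real^'n \<Rightarrow> ereal) \<Rightarrow> bool" where
  "closed_proper_convex h \<longleftrightarrow>
     closed (ereal_epigraph h) \<and>
     (\<forall>x. h x \<noteq> -\<infinity>) \<and> (\<exists>x. h x \<noteq> \<infinity>) \<and>
     convex (ereal_epigraph h)"

definition minimizer :: "(real^'n \<Rightarrow> ereal) \<Rightarrow> real^'n \<Rightarrow> bool" where
  "minimizer h x \<longleftrightarrow> is_arg_min h (\<lambda>_. True) x"

text \<open>The arg min is the set of all minimizers; a point-valued map \<open>D\<close> is the proximal
  operator of \<open>h\<close> when this set is \<open>{D x}\<close> for every \<open>x\<close>.\<close>

definition prox_set ::
    "(real^'n \<Rightarrow> real^'n \<Rightarrow> real) \<Rightarrow> (real^'n \<Rightarrow> ereal) \<Rightarrow> real^'n \<Rightarrow> (real^'n) set" where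
  "prox_set ip h x = {z. minimizer (\<lambda>y. ereal ((1/2) * (ip_norm ip (y - x))\<^sup>2) + h y) z}"

definition is_prox ::
    "(real^'n \<Rightarrow> real^'n \<Rightarrow> real) \<Rightarrow> (real^'n \<Rightarrow> ereal) \<Rightarrow> (real^'n \<Rightarrow> real^'n) \<Rightarrow> bool" where
  "is_prox ip h D \<longleftrightarrow> (\<forall>x. prox_set ip h x = {D x})"

primrec pnp_ista ::
    "(real^'n \<Rightarrow> real^'n \<Rightarrow> real) \<Rightarrow> (real^'n \<Rightarrow> real^'n) \<Rightarrow> (real^'n \<Rightarrow> real) \<Rightarrow> real \<Rightarrow>
     real^'n \<Rightarrow> nat \<Rightarrow> real^'n" where
  "pnp_ista ip D f \<rho> x0 0 = x0"
| "pnp_ista ip D f \<rho> x0 (Suc k) =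
     (let x = pnp_ista ip D f \<rho> x0 k in D (x - inverse \<rho> *\<^sub>R ip_gradient ip f x))"

end

theory Submission
  imports Defs
begin

text \<open>In the coordinates \<open>u = V\<^sup>-\<^sup>1 x\<close> the inner product becomes the standard one and the iteration is
  the proximal gradient method with step size \<open>1 / \<rho> < 2 / \<beta>\<close>. Proximal maps are firmly nonexpansive
  and \<open>\<nabla>f\<close> is cocoercive (Baillon--Haddad), so the distances to any fixed point decrease by an amount
  that controls the residuals. The residuals therefore vanish, cluster points are fixed points, and
  monotonicity of the distance to a cluster point gives convergence of the whole sequence. Fixed
  points are exactly the minimizers. The objective need not be continuous along the iterates: its
  upper limit is bounded by the proximal inequality at the limit point, its lower limit by minimality.\<close>

section \<open>First-order inequalities for convex and smooth functions\<close>

text \<open>Dividing \<open>incr\<close> by \<open>t\<close> bounds the difference quotients along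
  \<open>d\<close> from below by \<open>c\<close>, and the bound survives the limit from the right.
  It turns inequalities on segments into first-order conditions.\<close>

lemma gradient_lower_bound:
  fixes f :: "'a::euclidean_space \<Rightarrow> real"
  assumes der: "(f has_derivative (\<lambda>h. v \<bullet> h)) (at x)"
    and incr: "\<And>t. 0 < t \<Longrightarrow> t \<le> 1 \<Longrightarrow> f x + t * c \<le> f (x + t *\<^sub>R d)"
  shows "c \<le> v \<bullet> d"
proof -
  have "((\<lambda>t. f (x + t *\<^sub>R d)) has_derivative (\<lambda>t. v \<bullet> (t *\<^sub>R d))) (at 0)"
    by (rule has_derivative_compose[where g = f and g' = "\<lambda>h. v \<bullet> h"])
      (use der in \<open>auto intro!: derivative_eq_intros\<close>)
  then have "((\<lambda>t. f (x + t *\<^sub>R d)) has_real_derivative v \<bullet> d) (at 0)"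
    by (simp add: has_field_derivative_def mult.commute[of "v \<bullet> d"] mult_commute_abs)
  then have "((\<lambda>t. (f (x + t *\<^sub>R d) - f x) / t) \<longlongrightarrow> v \<bullet> d) (at 0)"
    by (simp add: DERIV_def)
  then have lim: "((\<lambda>t. (f (x + t *\<^sub>R d) - f x) / t) \<longlongrightarrow> v \<bullet> d) (at_right 0)"
    by (rule filterlim_mono) (auto intro: at_le)
  have "\<forall>\<^sub>F t in at_right (0::real). t \<in> {0<..<1}"
    by (rule eventually_at_right_real) simp
  then have "\<forall>\<^sub>F t in at_right 0. c \<le> (f (x + t *\<^sub>R d) - f x) / t"
    by eventually_elim (use incr in \<open>force simp: field_simps\<close>)
  with lim show ?thesis
    by (rule tendsto_lowerbound) simp
qed

text \<open>The chord inequality on the segment from \<open>x\<close> to \<open>y\<close>, negated,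
  is the growth hypothesis of \<open>gradient_lower_bound\<close> for \<open>- f\<close>.\<close>

lemma convex_on_gradient_le:
  fixes f :: "'a::euclidean_space \<Rightarrow> real"
  assumes "convex_on UNIV f" and "(f has_derivative (\<lambda>h. v \<bullet> h)) (at x)"
  shows "f x + v \<bullet> (y - x) \<le> f y"
proof -
  have "- (f y - f x) \<le> (- v) \<bullet> (y - x)"
  proof (rule gradient_lower_bound)
    show "((\<lambda>x. - f x) has_derivative (\<lambda>h. (- v) \<bullet> h)) (at x)"
      using has_derivative_minus[OF assms(2)] by simp
    fix t :: real assume "0 < t" "t \<le> 1"
    then have "f ((1 - t) *\<^sub>R x + t *\<^sub>R y) \<le> (1 - t) * f x + t * f y"
      using assms(1) by (intro convex_onD) auto
    moreover have "(1 - t) *\<^sub>R x + t *\<^sub>R y = x + t *\<^sub>R (y - x)"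
      by (simp add: algebra_simps)
    ultimately show "- f x + t * - (f y - f x) \<le> - f (x + t *\<^sub>R (y - x))"
      by (simp add: algebra_simps)
  qed
  then show ?thesis by simp
qed

text \<open>Up to a constant, \<open>\<phi>\<close> is \<open>f\<close> along the segment minus the
  claimed bound. Cauchy-Schwarz and the Lipschitz condition make its derivative nonpositive on the
  unit interval.\<close>

lemma descent_lemma:
  fixes f :: "'a::euclidean_space \<Rightarrow> real"
  assumes der: "\<And>x. (f has_derivative (\<lambda>h. G x \<bullet> h)) (at x)"
    and lip: "\<And>x y. norm (G x - G y) \<le> \<beta> * norm (x - y)"
  shows "f y \<le> f x + G x \<bullet> (y - x) + \<beta> / 2 * (norm (y - x))\<^sup>2"
proof -
  define d where "d = y - x"
  define \<phi> where "\<phi> = (\<lambda>t. f (x + t *\<^sub>R d) - t * (G x \<bullet> d) - \<beta> / 2 * t\<^sup>2 * (norm d)\<^sup>2)"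
  have "\<phi> 1 \<le> \<phi> 0"
  proof (rule DERIV_nonpos_imp_nonincreasing[where f = \<phi>])
    fix t :: real assume t: "0 \<le> t" "t \<le> 1"
    have "((\<lambda>t. f (x + t *\<^sub>R d)) has_derivative (\<lambda>s. G (x + t *\<^sub>R d) \<bullet> (s *\<^sub>R d))) (at t)"
      by (rule has_derivative_compose[where g = f and g' = "\<lambda>h. G (x + t *\<^sub>R d) \<bullet> h"])
        (use der in \<open>auto intro!: derivative_eq_intros\<close>)
    then have "((\<lambda>t. f (x + t *\<^sub>R d)) has_real_derivative G (x + t *\<^sub>R d) \<bullet> d) (at t)"
      by (simp add: has_field_derivative_def mult_commute_abs)
    then have "(\<phi> has_real_derivative
        G (x + t *\<^sub>R d) \<bullet> d - G x \<bullet> d - \<beta> * t * (norm d)\<^sup>2) (at t)"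
      unfolding \<phi>_def by (auto intro!: derivative_eq_intros)
    moreover have "(G (x + t *\<^sub>R d) - G x) \<bullet> d \<le> \<beta> * t * (norm d)\<^sup>2"
    proof -
      have "(G (x + t *\<^sub>R d) - G x) \<bullet> d \<le> norm (G (x + t *\<^sub>R d) - G x) * norm d"
        by (rule norm_cauchy_schwarz)
      also have "\<dots> \<le> (\<beta> * norm (x + t *\<^sub>R d - x)) * norm d"
        by (intro mult_right_mono lip) simp
      finally show ?thesis
        using t by (simp add: power2_eq_square)
    qed
    ultimately show "\<exists>y. (\<phi> has_real_derivative y) (at t) \<and> y \<le> 0"
      by (intro exI conjI) (auto simp: inner_diff_left)
  qed simp
  then show ?thesis by (simp add: \<phi>_def d_def)
qed

text \<open>The tangent at \<open>x\<close> bounds \<open>f (y + e)\<close> from below, the descent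
  lemma at \<open>y\<close> from above. With the best \<open>e\<close> this sharpens the gradient
  inequality by a quadratic term; adding the version with \<open>x\<close> and \<open>y\<close>
  exchanged gives cocoercivity.\<close>

lemma baillon_haddad:
  fixes f :: "'a::euclidean_space \<Rightarrow> real"
  assumes conv: "convex_on UNIV f"
    and der: "\<And>x. (f has_derivative (\<lambda>h. G x \<bullet> h)) (at x)"
    and lip: "\<And>x y. norm (G x - G y) \<le> \<beta> * norm (x - y)"
    and pos: "\<beta> > 0"
  shows "(norm (G x - G y))\<^sup>2 \<le> \<beta> * ((G x - G y) \<bullet> (x - y))"
proof -
  have half: "f x + G x \<bullet> (y - x) + (norm (G x - G y))\<^sup>2 / (2 * \<beta>) \<le> f y" for x y
  proof -
    \<comment> \<open>This \<open>e\<close> maximizes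
      \<open>(G x - G y) \<bullet> e - \<beta> / 2 * (norm e)\<^sup>2\<close>, the gain obtained
      from comparing the two bounds.\<close>
    define e where "e = (1 / \<beta>) *\<^sub>R (G x - G y)"
    have "f x + G x \<bullet> (y + e - x) \<le> f (y + e)"
      by (rule convex_on_gradient_le[OF conv der])
    also have "\<dots> \<le> f y + G y \<bullet> e + \<beta> / 2 * (norm e)\<^sup>2"
      using descent_lemma[OF der lip, of "y + e" y] by simp
    finally have "f x + G x \<bullet> (y - x) + (G x - G y) \<bullet> e - \<beta> / 2 * (norm e)\<^sup>2 \<le> f y"
      by (simp add: algebra_simps)
    moreover have "(G x - G y) \<bullet> e = (norm (G x - G y))\<^sup>2 / \<beta>"
      by (simp add: e_def power2_norm_eq_inner)
    moreover have "\<beta> / 2 * (norm e)\<^sup>2 = (norm (G x - G y))\<^sup>2 / (2 * \<beta>)"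
      using pos by (simp add: e_def power_mult_distrib power_divide) (simp add: power2_eq_square)
    ultimately show ?thesis
      using pos by (simp add: field_simps)
  qed
  have "(norm (G x - G y))\<^sup>2 / \<beta> \<le> (G x - G y) \<bullet> (x - y)"
    using half[of x y] half[of y x] pos
    by (simp add: algebra_simps norm_minus_commute add_divide_distrib[symmetric])
  then show ?thesis
    using pos by (simp add: field_simps)
qed

section \<open>Fermat's rule for a differentiable plus a convex function\<close>

text \<open>Minimality of \<open>p\<close> against points of the segment towards \<open>y\<close>,
  with \<open>g\<close> bounded there by its chord, gives \<open>\<phi>\<close> linear growth at
  rate \<open>c * (g p - g y)\<close>. It serves both for the proximal map (\<open>\<phi>\<close>
  half a squared distance) and for minimizers of the objective (\<open>\<phi>\<close> equal to
  \<open>f\<close>).\<close>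

lemma minimizer_sum_subgradient:
  fixes \<phi> :: "'a::euclidean_space \<Rightarrow> real" and g :: "'a \<Rightarrow> ereal"
  assumes conv: "convex {(x, r). g x \<le> ereal r}"
    and ninf: "\<And>x. g x \<noteq> -\<infinity>"
    and c: "c > 0"
    and fin: "g p \<noteq> \<infinity>"
    and min: "\<And>y. ereal (\<phi> p) + ereal c * g p \<le> ereal (\<phi> y) + ereal c * g y"
    and der: "(\<phi> has_derivative (\<lambda>h. v \<bullet> h)) (at p)"
  shows "g p + ereal (((- 1 / c) *\<^sub>R v) \<bullet> (y - p)) \<le> g y"
proof (cases "g y")
  case (real b)
  obtain a where a: "g p = ereal a"
    using fin ninf[of p] by (cases "g p") auto
  have "c * (a - b) \<le> v \<bullet> (y - p)"
  proof (rule gradient_lower_bound[OF der])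
    fix t :: real assume t: "0 < t" "t \<le> 1"
    have "(1 - t) *\<^sub>R (p, a) + t *\<^sub>R (y, b) \<in> {(x, r). g x \<le> ereal r}"
      by (rule convexD[OF conv]) (use t a real in auto)
    moreover have "(1 - t) *\<^sub>R p + t *\<^sub>R y = p + t *\<^sub>R (y - p)"
      by (simp add: algebra_simps)
    ultimately have le: "g (p + t *\<^sub>R (y - p)) \<le> ereal ((1 - t) * a + t * b)"
      by simp
    then obtain s where s: "g (p + t *\<^sub>R (y - p)) = ereal s"
      using ninf[of "p + t *\<^sub>R (y - p)"] by (cases "g (p + t *\<^sub>R (y - p))") auto
    have "c * s \<le> c * ((1 - t) * a + t * b)"
      using le s c by simp
    moreover have "\<phi> p + c * a \<le> \<phi> (p + t *\<^sub>R (y - p)) + c * s"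
      using min[of "p + t *\<^sub>R (y - p)"] a s by simp
    ultimately show "\<phi> p + t * (c * (a - b)) \<le> \<phi> (p + t *\<^sub>R (y - p))"
      by (simp add: algebra_simps)
  qed
  then show ?thesis
    using c a real by (simp add: field_simps)
qed (use ninf in auto)

section \<open>Convergence of the iterates by Fejer monotonicity\<close>

lemma forward_backward_converges:
  fixes f :: "'a::euclidean_space \<Rightarrow> real" and D G :: "'a \<Rightarrow> 'a"
  assumes conv: "convex_on UNIV f"
    and der: "\<And>x. (f has_derivative (\<lambda>h. G x \<bullet> h)) (at x)"
    and lip: "\<And>x y. norm (G x - G y) \<le> \<beta> * norm (x - y)"
    and pos: "\<beta> > 0" and \<rho>: "\<rho> > \<beta> / 2"
    and firm: "\<And>x y. (norm (D x - D y))\<^sup>2 \<le> (D x - D y) \<bullet> (x - y)"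
    and fix0: "D (z0 - (1 / \<rho>) *\<^sub>R G z0) = z0"
    and step: "\<And>k. x (Suc k) = D (x k - (1 / \<rho>) *\<^sub>R G (x k))"
  obtains z where "D (z - (1 / \<rho>) *\<^sub>R G z) = z" and "x \<longlonglongrightarrow> z"
proof -
  \<comment> \<open>\<open>S\<close> is the forward gradient step. \<open>c\<close> is the
    coefficient that remains for the squared gradient difference after cocoercivity has been used;
    it is positive because \<open>\<rho> > \<beta> / 2\<close>.\<close>
  define S where "S = (\<lambda>x. x - (1 / \<rho>) *\<^sub>R G x)"
  define c where "c = (1 / \<rho>) * (2 / \<beta> - 1 / \<rho>)"
  have \<rho>0: "\<rho> > 0" using pos \<rho> by simp
  have c: "c > 0" using pos \<rho> \<rho>0 by (simp add: c_def field_simps)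
  have contG: "continuous_on UNIV G"
    by (rule lipschitz_on_continuous_on[of \<beta>])
      (use lip pos in \<open>auto simp: lipschitz_on_def dist_norm\<close>)
  have nonexp: "norm (D x - D y) \<le> 1 * norm (x - y)" for x y
  proof -
    have "(norm (D x - D y))\<^sup>2 \<le> norm (D x - D y) * norm (x - y)"
      using firm[of x y] norm_cauchy_schwarz[of "D x - D y" "x - y"] by linarith
    then show ?thesis
      by (cases "norm (D x - D y) = 0") (simp_all add: power2_eq_square)
  qed
  have contD: "continuous_on UNIV D"
    by (rule lipschitz_on_continuous_on[of 1])
      (use nonexp in \<open>auto simp: lipschitz_on_def dist_norm\<close>)
  have contT: "continuous_on UNIV (\<lambda>x. D (S x))"
    unfolding S_def
    by (rule continuous_on_compose2[OF contD]) (auto intro!: continuous_intros contG)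
  \<comment> \<open>With \<open>q = u - (1 / \<rho>) *\<^sub>R w\<close>, firm nonexpansiveness says
    that the squares of \<open>p\<close> and \<open>q - p\<close> sum to at most that of
    \<open>q\<close>; the latter is then expanded and its cross term absorbed.\<close>
  have fejer: "(norm (x (Suc k) - z))\<^sup>2 + c * (norm (G (x k) - G z))\<^sup>2
      + (norm ((x k - x (Suc k)) - (1 / \<rho>) *\<^sub>R (G (x k) - G z)))\<^sup>2 \<le> (norm (x k - z))\<^sup>2"
    if z: "D (S z) = z" for z k
  proof -
    define p where "p = x (Suc k) - z"
    define u where "u = x k - z"
    define w where "w = G (x k) - G z"
    have "(norm p)\<^sup>2 \<le> p \<bullet> (u - (1 / \<rho>) *\<^sub>R w)"
      using firm[of "S (x k)" "S z"] z
      by (simp add: p_def u_def w_def S_def step algebra_simps)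
    moreover have "(norm (q - p))\<^sup>2 = (norm q)\<^sup>2 - 2 * (p \<bullet> q) + (norm p)\<^sup>2" for q
      unfolding power2_norm_eq_inner by (simp add: algebra_simps inner_commute)
    from this[of "u - (1 / \<rho>) *\<^sub>R w"]
    have "(norm (u - p - (1 / \<rho>) *\<^sub>R w))\<^sup>2 = (norm (u - (1 / \<rho>) *\<^sub>R w))\<^sup>2
        - 2 * (p \<bullet> (u - (1 / \<rho>) *\<^sub>R w)) + (norm p)\<^sup>2"
      by (simp add: diff_diff_eq add.commute)
    ultimately have "(norm p)\<^sup>2 + (norm (u - p - (1 / \<rho>) *\<^sub>R w))\<^sup>2 \<le> (norm (u - (1 / \<rho>) *\<^sub>R w))\<^sup>2"
      by linarith
    also have "\<dots> = (norm u)\<^sup>2 - 2 / \<rho> * (w \<bullet> u) + (1 / \<rho>)\<^sup>2 * (norm w)\<^sup>2"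
      unfolding power2_norm_eq_inner by (simp add: algebra_simps inner_commute power2_eq_square)
    also have "\<dots> \<le> (norm u)\<^sup>2 - c * (norm w)\<^sup>2"
    proof -
      \<comment> \<open>The factor \<open>2 / (\<rho> * \<beta>)\<close> makes cocoercivity match
        the cross term \<open>2 / \<rho> * (w \<bullet> u)\<close>.\<close>
      have "2 / (\<rho> * \<beta>) * (norm w)\<^sup>2 \<le> 2 / (\<rho> * \<beta>) * (\<beta> * (w \<bullet> u))"
        using baillon_haddad[OF conv der lip pos, of "x k" z] pos \<rho>0
        by (intro mult_left_mono) (simp_all add: w_def u_def)
      then show ?thesis
        using pos \<rho>0 by (simp add: c_def algebra_simps power2_eq_square)
    qed
    finally show ?thesis
      by (simp add: p_def u_def w_def algebra_simps)
  qed
  have mono: "norm (x (Suc k) - z) \<le> norm (x k - z)" if "D (S z) = z" for z k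
  proof (rule power2_le_imp_le)
    have "0 \<le> c * (norm (G (x k) - G z))\<^sup>2" using c by simp
    then show "(norm (x (Suc k) - z))\<^sup>2 \<le> (norm (x k - z))\<^sup>2"
      using fejer[OF that, of k]
        zero_le_power2[of "norm ((x k - x (Suc k)) - (1 / \<rho>) *\<^sub>R (G (x k) - G z))"]
      by linarith
  qed simp
  have dec: "decseq (\<lambda>k. norm (x k - z))" if "D (S z) = z" for z
    using mono[OF that] by (simp add: decseq_Suc_iff)
  have z0: "D (S z0) = z0" using fix0 by (simp add: S_def)
  obtain l where l: "(\<lambda>k. norm (x k - z0)) \<longlonglongrightarrow> l"
    using decseq_convergent[OF dec[OF z0], of 0] by auto
  \<comment> \<open>Consecutive squared distances share a limit, so their difference, which
    dominates both residuals in \<open>fejer\<close>, vanishes.\<close>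
  have gap: "(\<lambda>k. (norm (x k - z0))\<^sup>2 - (norm (x (Suc k) - z0))\<^sup>2) \<longlonglongrightarrow> 0"
    using tendsto_diff[OF tendsto_power[OF l, of 2] tendsto_power[OF LIMSEQ_Suc[OF l], of 2]]
    by simp
  have "(\<lambda>k. c * (norm (G (x k) - G z0))\<^sup>2) \<longlonglongrightarrow> 0"
  proof (rule tendsto_sandwich[OF _ _ tendsto_const gap]; intro always_eventually allI)
    fix k show "c * (norm (G (x k) - G z0))\<^sup>2 \<le> (norm (x k - z0))\<^sup>2 - (norm (x (Suc k) - z0))\<^sup>2"
      using fejer[OF z0, of k]
        zero_le_power2[of "norm ((x k - x (Suc k)) - (1 / \<rho>) *\<^sub>R (G (x k) - G z0))"]
      by linarith
  qed (use c in simp)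
  from tendsto_mult_left[OF this, of "1 / c"]
  have "(\<lambda>k. (norm (G (x k) - G z0))\<^sup>2) \<longlonglongrightarrow> 0" using c by simp
  from tendsto_real_sqrt[OF this]
  have G0: "(\<lambda>k. G (x k) - G z0) \<longlonglongrightarrow> 0" by (simp add: tendsto_norm_zero_iff)
  have "(\<lambda>k. (norm ((x k - x (Suc k)) - (1 / \<rho>) *\<^sub>R (G (x k) - G z0)))\<^sup>2) \<longlonglongrightarrow> 0"
  proof (rule tendsto_sandwich[OF _ _ tendsto_const gap]; intro always_eventually allI)
    fix k
    have "0 \<le> c * (norm (G (x k) - G z0))\<^sup>2" using c by simp
    then show "(norm ((x k - x (Suc k)) - (1 / \<rho>) *\<^sub>R (G (x k) - G z0)))\<^sup>2
        \<le> (norm (x k - z0))\<^sup>2 - (norm (x (Suc k) - z0))\<^sup>2"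
      using fejer[OF z0, of k] by linarith
  qed simp
  from tendsto_real_sqrt[OF this]
  have "(\<lambda>k. (x k - x (Suc k)) - (1 / \<rho>) *\<^sub>R (G (x k) - G z0)) \<longlonglongrightarrow> 0"
    by (simp add: tendsto_norm_zero_iff)
  \<comment> \<open>The gradient part of the second residual vanishes by \<open>G0\<close>, which
    leaves the difference of consecutive iterates.\<close>
  from tendsto_add[OF this tendsto_scaleR[OF tendsto_const[of "1 / \<rho>"] G0]]
  have diff: "(\<lambda>k. x k - x (Suc k)) \<longlonglongrightarrow> 0" by simp
  have "x k \<in> cball z0 (norm (x 0 - z0))" for k
    using decseqD[OF dec[OF z0], of 0 k] by (simp add: dist_norm norm_minus_commute)
  then have "\<exists>z r. z \<in> cball z0 (norm (x 0 - z0)) \<and> strict_mono r \<and> (x \<circ> r) \<longlonglongrightarrow> z"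
    using compact_cball[of z0 "norm (x 0 - z0)"] unfolding compact_def by metis
  then obtain z r where r: "strict_mono r" and xr: "(\<lambda>k. x (r k)) \<longlonglongrightarrow> z"
    by (auto simp: o_def)
  have "(\<lambda>k. D (S (x (r k)))) \<longlonglongrightarrow> D (S z)"
    using continuous_on_tendsto_compose[OF contT xr] by simp
  \<comment> \<open>The subsequence advanced by one step has the same limit \<open>z\<close> because
    consecutive iterates merge; by continuity it also tends to \<open>D (S z)\<close>.\<close>
  moreover have "(\<lambda>k. x (r k) - (x (r k) - x (Suc (r k)))) \<longlonglongrightarrow> z - 0"
    by (rule tendsto_diff[OF xr]) (use LIMSEQ_subseq_LIMSEQ[OF diff r] in \<open>simp add: o_def\<close>)
  then have "(\<lambda>k. D (S (x (r k)))) \<longlonglongrightarrow> z"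
    by (simp add: step S_def)
  ultimately have z: "D (S z) = z"
    by (rule LIMSEQ_unique)
  \<comment> \<open>Monotonicity of the distance is now used at the cluster point itself: the whole
    sequence of distances converges, and the subsequence forces its limit to be 0.\<close>
  obtain m where m: "(\<lambda>k. norm (x k - z)) \<longlonglongrightarrow> m"
    using decseq_convergent[OF dec[OF z], of 0] by auto
  have "(\<lambda>k. norm (x (r k) - z)) \<longlonglongrightarrow> m"
    using LIMSEQ_subseq_LIMSEQ[OF m r] by (simp add: o_def)
  moreover have "(\<lambda>k. norm (x (r k) - z)) \<longlonglongrightarrow> 0"
    using xr by (simp add: LIM_zero_iff tendsto_norm_zero_iff)
  ultimately have "m = 0"
    by (rule LIMSEQ_unique)
  then have "x \<longlonglongrightarrow> z"
    using m by (simp add: tendsto_norm_zero_iff LIM_zero_iff)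
  then show thesis
    using that z by (simp add: S_def)
qed

section \<open>Minimizers, fixed points and objective values in the standard inner product\<close>

lemma proximal_gradient_converges:
  fixes f :: "'a::euclidean_space \<Rightarrow> real" and g :: "'a \<Rightarrow> ereal" and D G :: "'a \<Rightarrow> 'a"
  assumes conv: "convex_on UNIV f"
    and der: "\<And>x. (f has_derivative (\<lambda>h. G x \<bullet> h)) (at x)"
    and lip: "\<And>x y. norm (G x - G y) \<le> \<beta> * norm (x - y)"
    and pos: "\<beta> > 0" and \<rho>: "\<rho> > \<beta> / 2"
    and gconv: "convex {(x, r). g x \<le> ereal r}"
    and ninf: "\<And>x. g x \<noteq> -\<infinity>"
    and proper: "g w \<noteq> \<infinity>"
    and prox: "\<And>x y. ereal ((norm (D x - x))\<^sup>2 / 2) + g (D x) \<le> ereal ((norm (y - x))\<^sup>2 / 2) + g y"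
    and min: "\<And>y. ereal (f x') + ereal \<rho> * g x' \<le> ereal (f y) + ereal \<rho> * g y"
    and step: "\<And>k. x (Suc k) = D (x k - (1 / \<rho>) *\<^sub>R G (x k))"
  obtains z where "\<And>y. ereal (f z) + ereal \<rho> * g z \<le> ereal (f y) + ereal \<rho> * g y"
    and "x \<longlonglongrightarrow> z"
    and "(\<lambda>k. ereal (f (x k)) + ereal \<rho> * g (x k)) \<longlonglongrightarrow> ereal (f x') + ereal \<rho> * g x'"
proof -
  have \<rho>0: "\<rho> > 0" using pos \<rho> by simp
  \<comment> \<open>Comparison with the point \<open>w\<close> of the domain shows that
    \<open>g\<close> is finite on the range of \<open>D\<close>; \<open>\<gamma>\<close> allows real
    arithmetic there.\<close>
  obtain \<gamma> where \<gamma>: "\<And>x. g (D x) = ereal (\<gamma> x)"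
  proof -
    have "g (D x) \<noteq> \<infinity>" for x
      using prox[of x w] ninf[of w] proper by (cases "g w") auto
    then have "g (D x) = ereal (real_of_ereal (g (D x)))" for x
      using ninf[of "D x"] by (cases "g (D x)") auto
    then show thesis by (rule that)
  qed
  \<comment> \<open>The derivative of half the squared distance to \<open>x\<close>, taken at
    \<open>D x\<close>, is represented by \<open>D x - x\<close>, so \<open>x - D x\<close> is a
    subgradient of \<open>g\<close> at \<open>D x\<close>.\<close>
  have opt: "g (D x) + ereal ((x - D x) \<bullet> (y - D x)) \<le> g y" for x y
  proof -
    have "((\<lambda>y. (norm (y - x))\<^sup>2 / 2) has_derivative (\<lambda>h. (D x - x) \<bullet> h)) (at (D x))"
      unfolding power2_norm_eq_inner
      by (auto intro!: derivative_eq_intros simp: inner_commute)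
    from minimizer_sum_subgradient[OF gconv ninf _ _ _ this, of 1 y] show ?thesis
      using prox[of x] by (simp add: \<gamma> one_ereal_def[symmetric])
  qed
  \<comment> \<open>Monotonicity of the subdifferential: the two subgradient inequalities are
    added.\<close>
  have firm: "(norm (D x - D y))\<^sup>2 \<le> (D x - D y) \<bullet> (x - y)" for x y
    using opt[of x "D y"] opt[of y "D x"]
    by (simp add: \<gamma> power2_norm_eq_inner algebra_simps inner_commute)
  \<comment> \<open>Optimality makes \<open>s - x'\<close> a subgradient of \<open>g\<close> at
    \<open>x'\<close>, while \<open>s - D s\<close> is one at \<open>D s\<close>. Adding both
    inequalities forces \<open>D s = x'\<close>.\<close>
  have fix': "D (x' - (1 / \<rho>) *\<^sub>R G x') = x'"
  proof -
    define s where "s = x' - (1 / \<rho>) *\<^sub>R G x'"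
    have fin: "g x' \<noteq> \<infinity>"
      using min[of w] ninf[of w] proper \<rho>0 by (cases "g w") auto
    then obtain a where a: "g x' = ereal a"
      using ninf[of x'] by (cases "g x'") auto
    have "g x' + ereal (((- 1 / \<rho>) *\<^sub>R G x') \<bullet> (D s - x')) \<le> g (D s)"
      using minimizer_sum_subgradient[OF gconv ninf \<rho>0 fin min der] .
    then have "a + (s - x') \<bullet> (D s - x') \<le> \<gamma> s"
      by (simp add: a \<gamma> s_def)
    moreover have "\<gamma> s + (s - D s) \<bullet> (x' - D s) \<le> a"
      using opt[of s x'] by (simp add: a \<gamma>)
    ultimately have "(D s - x') \<bullet> (D s - x') \<le> 0"
      by (simp add: algebra_simps inner_commute)
    then have "(D s - x') \<bullet> (D s - x') = 0"
      by (rule antisym) simp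
    then show ?thesis by (simp add: s_def)
  qed
  obtain z where z: "D (z - (1 / \<rho>) *\<^sub>R G z) = z" and lim: "x \<longlonglongrightarrow> z"
    by (rule forward_backward_converges[where f = f and G = G and D = D and x = x,
          OF conv der lip pos \<rho> firm fix' step])
  obtain c where c: "g z = ereal c"
    using \<gamma>[of "z - (1 / \<rho>) *\<^sub>R G z"] z by auto
  \<comment> \<open>At the fixed point \<open>z\<close>, \<open>opt\<close> gives the subgradient
    \<open>- (1 / \<rho>) *\<^sub>R G z\<close> of \<open>g\<close>; scaled by \<open>\<rho>\<close>
    it cancels the gradient term of \<open>f\<close>.\<close>
  have zmin: "ereal (f z) + ereal \<rho> * g z \<le> ereal (f y) + ereal \<rho> * g y" for y
  proof (cases "g y")
    case (real b)
    have "c - (1 / \<rho>) * (G z \<bullet> (y - z)) \<le> b"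
      using opt[of "z - (1 / \<rho>) *\<^sub>R G z" y] z c real by simp
    then have "\<rho> * (c - (1 / \<rho>) * (G z \<bullet> (y - z))) \<le> \<rho> * b"
      using \<rho>0 by simp
    then have "\<rho> * c - G z \<bullet> (y - z) \<le> \<rho> * b"
      using \<rho>0 by (simp add: right_diff_distrib)
    moreover have "f z + G z \<bullet> (y - z) \<le> f y"
      by (rule convex_on_gradient_le[OF conv der])
    ultimately show ?thesis
      by (simp add: c real)
  qed (use ninf \<rho>0 in auto)
  define s where "s = (\<lambda>k. x k - (1 / \<rho>) *\<^sub>R G (x k))"
  have xs: "x (Suc k) = D (s k)" for k
    by (simp add: step s_def)
  have contG: "continuous_on UNIV G"
    by (rule lipschitz_on_continuous_on[of \<beta>])
      (use lip pos in \<open>auto simp: lipschitz_on_def dist_norm\<close>)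
  have contf: "isCont f z"
    using der by (rule has_derivative_continuous)
  have Glim: "(\<lambda>k. G (x k)) \<longlonglongrightarrow> G z"
    using continuous_on_tendsto_compose[OF contG lim] by simp
  have flim: "(\<lambda>k. f (x (Suc k))) \<longlonglongrightarrow> f z"
    using isCont_tendsto_compose[OF contf LIMSEQ_Suc[OF lim]] .
  \<comment> \<open>The index starts at 1 since \<open>g (x 0)\<close> may be infinite. Minimality
    of \<open>z\<close> bounds the values from below; \<open>opt\<close> tested at \<open>z\<close>
    bounds them from above, with an inner product that vanishes as \<open>x (Suc k)\<close> tends to
    \<open>z\<close> and \<open>s k\<close> converges.\<close>
  have "(\<lambda>k. f (x (Suc k)) + \<rho> * \<gamma> (s k)) \<longlonglongrightarrow> f z + \<rho> * c"
  proof (rule tendsto_sandwich; (intro always_eventually allI)?)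
    fix k
    show "f z + \<rho> * c \<le> f (x (Suc k)) + \<rho> * \<gamma> (s k)"
      using zmin[of "D (s k)"] by (simp add: c \<gamma> xs)
    have "\<gamma> (s k) + (s k - x (Suc k)) \<bullet> (z - x (Suc k)) \<le> c"
      using opt[of "s k" z] by (simp add: c \<gamma> xs)
    then show "f (x (Suc k)) + \<rho> * \<gamma> (s k)
        \<le> f (x (Suc k)) + \<rho> * (c - (s k - x (Suc k)) \<bullet> (z - x (Suc k)))"
      using \<rho>0 by simp
  next
    have "(\<lambda>k. f (x (Suc k)) + \<rho> * (c - (s k - x (Suc k)) \<bullet> (z - x (Suc k))))
        \<longlonglongrightarrow> f z + \<rho> * (c - (z - (1 / \<rho>) *\<^sub>R G z - z) \<bullet> (z - z))"
      unfolding s_def by (intro tendsto_intros flim Glim lim LIMSEQ_Suc)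
    then show "(\<lambda>k. f (x (Suc k)) + \<rho> * (c - (s k - x (Suc k)) \<bullet> (z - x (Suc k))))
        \<longlonglongrightarrow> f z + \<rho> * c"
      by simp
  qed simp
  then have "(\<lambda>k. ereal (f (x (Suc k))) + ereal \<rho> * g (x (Suc k)))
      \<longlonglongrightarrow> ereal (f z) + ereal \<rho> * g z"
    by (simp add: xs \<gamma> c)
  moreover have "ereal (f z) + ereal \<rho> * g z = ereal (f x') + ereal \<rho> * g x'"
    by (intro antisym zmin min)
  ultimately have "(\<lambda>k. ereal (f (x k)) + ereal \<rho> * g (x k)) \<longlonglongrightarrow> ereal (f x') + ereal \<rho> * g x'"
    by (simp add: LIMSEQ_imp_Suc[of "\<lambda>k. ereal (f (x k)) + ereal \<rho> * g (x k)"])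
  with that zmin lim show thesis by blast
qed

section \<open>Change of coordinates by the eigenvector matrix\<close>

text \<open>Injectivity of the column map gives the set of columns full cardinality, so its
  independence means full column rank.\<close>

lemma eigenvector_basis_invertible:
  fixes V :: "real^'n^'n"
  assumes "eigenvector_basis A V"
  shows "invertible V"
proof -
  have "card (columns V) = CARD('n)"
    using assms card_image[of "\<lambda>i. column i V" UNIV]
    by (simp add: eigenvector_basis_def columns_def full_SetCompr_eq)
  moreover have "dim (columns V) = card (columns V)"
    using assms by (intro dim_eq_card_independent) (simp add: eigenvector_basis_def)
  ultimately have "inj ((*v) V)"
    by (simp add: full_rank_injective[symmetric] column_rank_def)
  then show ?thesis
    by (simp add: invertible_left_inverse matrix_left_invertible_injective)
qed

lemma matrix_inv_mult:
  fixes V :: "'a::semiring_1^'n^'m"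
  assumes "invertible V"
  shows "V ** matrix_inv V = mat 1" and "matrix_inv V ** V = mat 1"
  using someI_ex[OF assms[unfolded invertible_def]] by (simp_all add: matrix_inv_def)

text \<open>The definite description in \<open>ip_gradient\<close> needs Riesz representation for
  the induced inner product: existence is pulled back through \<open>V\<close> to the standard one,
  uniqueness follows by testing the difference of two candidates against itself.\<close>

lemma ip_gradient_induced_inner:
  fixes V :: "real^'n^'n"
  assumes V: "invertible V" and f: "f differentiable (at x)"
  shows "frechet_derivative f (at x) h = induced_inner V (ip_gradient (induced_inner V) f x) h"
proof -
  define L where "L = frechet_derivative f (at x)"
  have inv: "matrix_inv V *v (V *v u) = u" "V *v (matrix_inv V *v u) = u" for u
    using V by (simp_all add: matrix_vector_mul_assoc matrix_inv_mult)
  have lin: "linear (\<lambda>u. L (V *v u))"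
    using linear_compose[OF matrix_vector_mul_linear linear_frechet_derivative[OF f], of V]
    by (simp add: L_def o_def)
  \<comment> \<open>The adjoint of a real functional, evaluated at 1, is its representing vector;
    \<open>V\<close> carries it back to the original coordinates.\<close>
  define v where "v = V *v adjoint (\<lambda>u. L (V *v u)) 1"
  have rep: "L h = induced_inner V v h" for h
    using adjoint_clauses(2)[OF lin, of 1 "matrix_inv V *v h"]
    by (simp add: induced_inner_def v_def inv)
  have "ip_gradient (induced_inner V) f x = v"
    unfolding ip_gradient_def
  proof (rule the_equality)
    show "\<forall>h. frechet_derivative f (at x) h = induced_inner V v h"
      using rep by (simp add: L_def)
    fix v' assume "\<forall>h. frechet_derivative f (at x) h = induced_inner V v' h"
    then have "induced_inner V v' (v' - v) = induced_inner V v (v' - v)"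
      using rep by (simp add: L_def)
    then have "(matrix_inv V *v (v' - v)) \<bullet> (matrix_inv V *v (v' - v)) = 0"
      by (simp add: induced_inner_def matrix_vector_mult_diff_distrib inner_diff_left)
    then have "V *v (matrix_inv V *v (v' - v)) = 0" by simp
    then show "v' = v" by (simp add: inv)
  qed
  then show ?thesis using rep by (simp add: L_def)
qed

theorem mainTheorem4:
  fixes W V :: "real^'n^'n"
    and D :: "real^'n \<Rightarrow> real^'n"
    and ip :: "real^'n \<Rightarrow> real^'n \<Rightarrow> real"
    and g :: "real^'n \<Rightarrow> ereal"
    and f :: "real^'n \<Rightarrow> real"
    and \<beta> \<rho> :: real
    and xstar x0 :: "real^'n"
    and pstar :: ereal
  assumes "\<And>x. D x = W *v x"
    and "diagonalizable W"
    and "\<And>\<mu>. eigenvalue W \<mu> \<Longrightarrow> \<mu> \<in> {0..1}"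
    and "eigenvector_basis W V"
    and "ip = induced_inner V"
    and "closed_proper_convex g"
    and "is_prox ip g D"
    and "convex_on UNIV f"
    and "\<beta> > 0"
    and "ip_smooth ip \<beta> f"
    and "\<rho> > \<beta> / 2"
    and "minimizer (\<lambda>x. ereal (f x) + ereal \<rho> * g x) xstar"
    and "pstar = ereal (f xstar) + ereal \<rho> * g xstar"
  shows "(\<exists>z. minimizer (\<lambda>x. ereal (f x) + ereal \<rho> * g x) z \<and>
              pnp_ista ip D f \<rho> x0 \<longlonglongrightarrow> z) \<and>
         (\<lambda>k. ereal (f (pnp_ista ip D f \<rho> x0 k)) + ereal \<rho> * g (pnp_ista ip D f \<rho> x0 k))
           \<longlonglongrightarrow> pstar"
proof -
  \<comment> \<open>\<open>A\<close> is an isometry from \<open>ip\<close> to the standard inner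
    product, with inverse \<open>V\<close>. All data are conjugated by it: \<open>f\<close> and
    \<open>g\<close> are composed with \<open>V\<close>, and \<open>D\<close> and the gradient
    become \<open>A *v D (V *v u)\<close> and \<open>A *v grad (V *v u)\<close>.\<close>
  define A where "A = matrix_inv V"
  have V: "invertible V"
    using assms(4) by (rule eigenvector_basis_invertible)
  have inv[simp]: "A *v (V *v u) = u" "V *v (A *v u) = u" for u
    using V by (simp_all add: A_def matrix_vector_mul_assoc matrix_inv_mult)
  have norm: "ip_norm ip x = norm (A *v x)" for x
    by (simp add: ip_norm_def assms(5) induced_inner_def A_def norm_eq_sqrt_inner)
  define grad where "grad = ip_gradient ip f"
  define x where "x = pnp_ista ip D f \<rho> x0"
  have diff: "f differentiable (at y)" for y
    using assms(10) by (simp add: ip_smooth_def)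
  have der: "((\<lambda>u. f (V *v u)) has_derivative (\<lambda>h. (A *v grad (V *v u)) \<bullet> h)) (at u)" for u
  proof -
    have "frechet_derivative f (at (V *v u)) = induced_inner V (grad (V *v u))"
      using ip_gradient_induced_inner[OF V diff, of "V *v u"] by (intro ext) (simp add: grad_def assms(5))
    then have "(f has_derivative induced_inner V (grad (V *v u))) (at (V *v u))"
      using frechet_derivative_works[of f "at (V *v u)"] diff by simp
    from has_derivative_compose[OF bounded_linear_imp_has_derivative[OF
          matrix_vector_mul_bounded_linear[of V]] this]
    show ?thesis
      by (simp add: induced_inner_def A_def[symmetric])
  qed
  have conv: "convex_on UNIV (\<lambda>u. f (V *v u))"
    using assms(8) by (simp add: convex_on_def matrix_vector_right_distrib matrix_vector_mult_scaleR)
  have lip: "norm (A *v grad (V *v u) - A *v grad (V *v v)) \<le> \<beta> * norm (u - v)" for u v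
  proof -
    have "ip_norm ip (grad (V *v u) - grad (V *v v)) \<le> \<beta> * ip_norm ip (V *v u - V *v v)"
      using assms(10) by (simp add: ip_smooth_def grad_def)
    then show ?thesis
      by (simp add: norm matrix_vector_mult_diff_distrib)
  qed
  \<comment> \<open>The new epigraph is the preimage of the old one under the linear map that
    applies \<open>V\<close> to the first component.\<close>
  have gconv: "convex {(u, r). g (V *v u) \<le> ereal r}"
  proof -
    have "linear (\<lambda>(u, r). (V *v u, r :: real))"
      by (rule linearI) (auto simp: matrix_vector_right_distrib matrix_vector_mult_scaleR)
    from convex_linear_vimage[OF this, of "ereal_epigraph g"] show ?thesis
      using assms(6)
      by (simp add: closed_proper_convex_def ereal_epigraph_def vimage_def case_prod_unfold)
  qed
  have ninf: "g (V *v u) \<noteq> -\<infinity>" for u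
    using assms(6) by (simp add: closed_proper_convex_def)
  obtain w where proper: "g (V *v (A *v w)) \<noteq> \<infinity>"
    using assms(6) by (auto simp: closed_proper_convex_def)
  have prox: "ereal ((norm (A *v D (V *v u) - u))\<^sup>2 / 2) + g (V *v (A *v D (V *v u)))
      \<le> ereal ((norm (v - u))\<^sup>2 / 2) + g (V *v v)" for u v
  proof -
    have "D (V *v u) \<in> prox_set ip g (V *v u)"
      using assms(7) by (simp add: is_prox_def)
    then have "ereal (1 / 2 * (ip_norm ip (D (V *v u) - V *v u))\<^sup>2) + g (D (V *v u))
        \<le> ereal (1 / 2 * (ip_norm ip (V *v v - V *v u))\<^sup>2) + g (V *v v)"
      by (simp add: prox_set_def minimizer_def is_arg_min_linorder)
    then show ?thesis
      by (simp add: norm matrix_vector_mult_diff_distrib)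
  qed
  have min: "ereal (f (V *v (A *v xstar))) + ereal \<rho> * g (V *v (A *v xstar))
      \<le> ereal (f (V *v v)) + ereal \<rho> * g (V *v v)" for v
    using assms(12) by (simp add: minimizer_def is_arg_min_linorder)
  have step: "A *v x (Suc k) = A *v D (V *v (A *v x k - (1 / \<rho>) *\<^sub>R (A *v grad (V *v (A *v x k)))))"
    for k
    by (simp add: x_def grad_def Let_def matrix_vector_mult_diff_distrib matrix_vector_mult_scaleR
        inverse_eq_divide)
  obtain z where
    zmin: "\<And>v. ereal (f (V *v z)) + ereal \<rho> * g (V *v z) \<le> ereal (f (V *v v)) + ereal \<rho> * g (V *v v)"
    and lim: "(\<lambda>k. A *v x k) \<longlonglongrightarrow> z"
    and val: "(\<lambda>k. ereal (f (V *v (A *v x k))) + ereal \<rho> * g (V *v (A *v x k)))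
      \<longlonglongrightarrow> ereal (f (V *v (A *v xstar))) + ereal \<rho> * g (V *v (A *v xstar))"
    by (rule proximal_gradient_converges[where f = "\<lambda>u. f (V *v u)" and g = "\<lambda>u. g (V *v u)"
          and G = "\<lambda>u. A *v grad (V *v u)" and D = "\<lambda>u. A *v D (V *v u)"
          and x = "\<lambda>k. A *v x k" and x' = "A *v xstar" and w = "A *v w",
          OF conv der lip assms(9) assms(11) gconv ninf proper prox min step])
      blast
  \<comment> \<open>Every competitor \<open>y\<close> is \<open>V *v (A *v y)\<close>, so minimality
    in the new coordinates covers all of the space.\<close>
  have "minimizer (\<lambda>x. ereal (f x) + ereal \<rho> * g x) (V *v z)"
    unfolding minimizer_def is_arg_min_linorder
  proof (intro conjI allI impI TrueI)
    fix y
    show "ereal (f (V *v z)) + ereal \<rho> * g (V *v z) \<le> ereal (f y) + ereal \<rho> * g y"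
      using zmin[of "A *v y"] by simp
  qed
  moreover have "x \<longlonglongrightarrow> V *v z"
    using bounded_linear.tendsto[OF matrix_vector_mul_bounded_linear[of V] lim] by simp
  ultimately show ?thesis
    using val assms(13) by (auto simp: x_def)
qed

end
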